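(* In general, $\mathcal{K}^c$-congruent $n$-subspaces are not first $\mathcal{K}^c$-congruent. That is, for every $n\ge 2$ there exist an $(n-2)$-subspace $\mathcal{K}\subset\mathbb{E}^n$ and $n$-subspaces $M, M'\subset \mathcal{K}^c$ such that $M$ and $M'$ are $\mathcal{K}^c$-congruent but are not first $\mathcal{K}^c$-congruent.
   Context: $\mathbb{E}^n$ is $n$-dimensional real Euclidean space and $\mathrm{SE}(n)=\mathbb{R}^n\rtimes\mathrm{SO}(n)$ is the Euclidean group. It acts on $\mathbb{E}^n$ by $\Phi_g(x)=Ax+u$ for $g=(u,A)$, $u\in\mathbb{R}^n$, $A\in\mathrm{SO}(n)$. Its Lie algebra is denoted $\mathfrak{se}(n)$, with exponential map $\exp:\mathfrak{se}(n)\to\mathrm{SE}(n)$. In matrix form, elements of $\mathfrak{se}(n)$ are $\begin{pmatrix}0&0\\ \xi&\omega\end{pmatrix}$ with $\xi\in\mathbb{R}^n$, $\omega\in\mathfrak{so}(n)$, and $g=(u,A)$ is $\begin{pmatrix}1&0\\ u&A\end{pmatrix}$, acting on $\begin{pmatrix}1\\ x\end{pmatrix}$. An $\ell$-subspace is an $\ell$-dimensional topological manifold in $\mathbb{E}^n$. It may be disconnected; in particular, the $(n-2)$-subspace $\mathcal{K}$ may be a disjoint union of finitely many connected parts. $\mathcal{K}^c=\mathbb{E}^n\setminus\mathcal{K}$. Two $n$-subspaces $M,M'$ are congruent if $\Phi_g(M)=M'$ for some $g\in\mathrm{SE}(n)$. $\mathcal{K}^c$-congruence: congruent $n$-subspaces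 $M,M'\subset\mathcal{K}^c$ with $\Phi_g(M)=M'$, $g\in \mathrm{SE}(n)$, are $\mathcal{K}^c$-congruent if there is a continuous map $\psi:[0,1]\to\mathrm{SE}(n)$ such that $\Phi_{\psi(0)}=\mathrm{id}$, $\Phi_{\psi(1)}=\Phi_g$, and $\Phi_{\psi(t)}(M)\cap\mathcal{K}=\emptyset$ for every $t\in(0,1)$. In that case $\Phi_\psi$ is called a $\mathcal{K}^c$-congruent homotopy for $M$ and $M'$. First $\mathcal{K}^c$-congruence: $\mathcal{K}^c$-congruent $M,M'$ are first $\mathcal{K}^c$-congruent if there is $\mathfrak{g}\in\mathfrak{se}(n)$ such that $\Phi_{\exp(\mathfrak{g})}(M)=M'$ and the simple Euclidean move $\psi(t)=\exp(t\mathfrak{g})$, $t\in[0,1]$, gives a $\mathcal{K}^c$-congruent homotopy for $M$ and $M'$, i.e. $\Phi_{\exp(t\mathfrak{g})}(M)\cap\mathcal{K}=\emptyset$ for every $t\in(0,1)$. *)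

theory Defs
  imports "HOL-Analysis.Analysis"
begin

subsection \<open>Subspaces\<close>

text \<open>Manifolds have no boundary and may be empty or disconnected.\<close>

definition topological_manifold :: "nat \<Rightarrow> 'a topology \<Rightarrow> bool" where
  "topological_manifold l X \<longleftrightarrow>
     Hausdorff_space X \<and> second_countable X \<and>
     (\<forall>x \<in> topspace X. \<exists>U V. openin X U \<and> x \<in> U \<and> openin (Euclidean_space l) V \<and>
        subtopology X U homeomorphic_space subtopology (Euclidean_space l) V)"

definition l_subspace :: "nat \<Rightarrow> (real ^ 'n) set \<Rightarrow> bool" where
  "l_subspace l S \<longleftrightarrow> topological_manifold l (top_of_set S)"

subsection \<open>The Euclidean group\<close>

text \<open>An element \<open>(u, A)\<close> stands for the motion \<open>x \<mapsto> A x + u\<close>.  The topology is that of a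
  subspace of the product of the vector space and the matrix space.\<close>

type_synonym 'n motion = "(real ^ 'n) \<times> (real ^ 'n ^ 'n)"

definition SE :: "'n::finite motion set" where
  "SE = {(u, A). rotation_matrix A}"

definition act :: "'n::finite motion \<Rightarrow> real ^ 'n \<Rightarrow> real ^ 'n" where
  "act g x = snd g *v x + fst g"

text \<open>Homogeneous coordinates: the extra coordinate, in which points have entry 1, has index
  \<^const>\<open>None\<close>.\<close>

definition SE_matrix :: "'n::finite motion \<Rightarrow> real ^ 'n option ^ 'n option" where
  "SE_matrix g = (\<chi> i j. case (i, j) of
       (None, None) \<Rightarrow> 1
     | (None, Some b) \<Rightarrow> 0
     | (Some a, None) \<Rightarrow> fst g $ a
     | (Some a, Some b) \<Rightarrow> snd g $ a $ b)"

subsection \<open>The Lie algebra and its exponential map\<close>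

definition se :: "'n::finite motion set" where
  "se = {(\<xi>, \<omega>). transpose \<omega> = - \<omega>}"

definition se_matrix :: "'n::finite motion \<Rightarrow> real ^ 'n option ^ 'n option" where
  "se_matrix \<gg> = (\<chi> i j. case (i, j) of
       (None, None) \<Rightarrow> 0
     | (None, Some b) \<Rightarrow> 0
     | (Some a, None) \<Rightarrow> fst \<gg> $ a
     | (Some a, Some b) \<Rightarrow> snd \<gg> $ a $ b)"

primrec mat_pow :: "real ^ 'm ^ 'm \<Rightarrow> nat \<Rightarrow> real ^ 'm ^ 'm" where
  "mat_pow A 0 = mat 1"
| "mat_pow A (Suc k) = A ** mat_pow A k"

definition mat_exp :: "real ^ 'm ^ 'm \<Rightarrow> real ^ 'm ^ 'm" where
  "mat_exp A = (\<Sum>k. (1 / fact k) *\<^sub>R mat_pow A k)"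

text \<open>The pair represented by the exponential of the matrix of \<open>\<gg>\<close>;
  \<open>SE_matrix_exp_se\<close> below shows that reading off the two blocks loses nothing.\<close>

definition exp_se :: "'n::finite motion \<Rightarrow> 'n motion" where
  "exp_se \<gg> = (let E = mat_exp (se_matrix \<gg>) in
     (\<chi> a. E $ Some a $ None, \<chi> a b. E $ Some a $ Some b))"

lemma mat_pow_entry_le:
  fixes A :: "real ^ 'm ^ 'm"
  shows "\<bar>mat_pow A k $ i $ j\<bar> \<le> (\<Sum>a\<in>UNIV. \<Sum>b\<in>UNIV. \<bar>A $ a $ b\<bar>) ^ k"
proof (induction k arbitrary: i)
  case 0
  show ?case by (simp add: mat_def)
next
  case (Suc k)
  let ?B = "\<Sum>a\<in>UNIV. \<Sum>b\<in>UNIV. \<bar>A $ a $ b\<bar>"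
  have "\<bar>mat_pow A (Suc k) $ i $ j\<bar> = \<bar>\<Sum>l\<in>UNIV. A $ i $ l * mat_pow A k $ l $ j\<bar>"
    by (simp add: matrix_matrix_mult_def)
  also have "\<dots> \<le> (\<Sum>l\<in>UNIV. \<bar>A $ i $ l\<bar> * \<bar>mat_pow A k $ l $ j\<bar>)"
    by (rule order_trans[OF sum_abs]) (simp add: abs_mult)
  also have "\<dots> \<le> (\<Sum>l\<in>UNIV. \<bar>A $ i $ l\<bar> * ?B ^ k)"
    by (intro sum_mono mult_left_mono Suc.IH) auto
  also have "\<dots> = (\<Sum>l\<in>UNIV. \<bar>A $ i $ l\<bar>) * ?B ^ k"
    by (simp add: sum_distrib_right)
  also have "\<dots> \<le> ?B * ?B ^ k"
    by (intro mult_right_mono member_le_sum[where f = "\<lambda>a. \<Sum>b\<in>UNIV. \<bar>A $ a $ b\<bar>"])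
       (auto intro!: sum_nonneg zero_le_power)
  finally show ?case by simp
qed

lemma summable_mat_exp:
  fixes A :: "real ^ 'm ^ 'm"
  shows "summable (\<lambda>k. (1 / fact k) *\<^sub>R mat_pow A k)"
proof (rule summable_comparison_test')
  let ?B = "\<Sum>a\<in>UNIV. \<Sum>b\<in>UNIV. \<bar>A $ a $ b\<bar>"
  let ?c = "real CARD('m) * real CARD('m)"
  show "summable (\<lambda>k. ?c * (inverse (fact k) * ?B ^ k))"
    by (intro summable_mult summable_exp)
  fix k :: nat
  have "norm (mat_pow A k) \<le> (\<Sum>i\<in>UNIV. norm (mat_pow A k $ i))"
    unfolding norm_vec_def by (rule L2_set_le_sum) simp
  also have "\<dots> \<le> (\<Sum>i\<in>UNIV. \<Sum>j\<in>UNIV. \<bar>mat_pow A k $ i $ j\<bar>)"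
    by (intro sum_mono norm_le_l1_cart)
  also have "\<dots> \<le> (\<Sum>i\<in>(UNIV::'m set). \<Sum>j\<in>(UNIV::'m set). ?B ^ k)"
    by (intro sum_mono mat_pow_entry_le)
  also have "\<dots> = ?c * ?B ^ k" by simp
  finally show "norm ((1 / fact k) *\<^sub>R mat_pow A k) \<le> ?c * (inverse (fact k) * ?B ^ k)"
    by (simp add: field_simps)
qed

lemma mat_exp_entry_sums:
  fixes A :: "real ^ 'm ^ 'm"
  shows "(\<lambda>k. (1 / fact k) * mat_pow A k $ i $ j) sums (mat_exp A $ i $ j)"
proof -
  have "(\<lambda>k. (1 / fact k) *\<^sub>R mat_pow A k) sums mat_exp A"
    unfolding mat_exp_def by (rule summable_sums[OF summable_mat_exp])
  from bounded_linear.sums[OF bounded_linear_vec_nth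
        bounded_linear.sums[OF bounded_linear_vec_nth this]]
  show ?thesis by simp
qed

lemma SE_matrix_exp_se: "SE_matrix (exp_se \<gg>) = mat_exp (se_matrix \<gg>)"
proof -
  let ?E = "mat_exp (se_matrix \<gg>)"
  have row: "mat_pow (se_matrix \<gg>) k $ None $ j = (if k = 0 then mat 1 $ None $ j else 0)" for k j
    by (cases k) (auto simp: matrix_matrix_mult_def se_matrix_def intro!: sum.neutral
                       split: option.splits)
  have "?E $ None $ j = mat 1 $ None $ j" for j
  proof (rule sums_unique2[OF mat_exp_entry_sums])
    show "(\<lambda>k. (1 / fact k) * mat_pow (se_matrix \<gg>) k $ None $ j) sums (mat 1 $ None $ j)"
      using sums_single[of 0 "\<lambda>_. mat 1 $ None $ j :: real"]
      by (rule sums_cong[THEN iffD1, rotated]) (auto simp: row)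
  qed
  then show ?thesis
    by (auto simp: vec_eq_iff SE_matrix_def exp_se_def Let_def mat_def split: option.split)
qed

subsection \<open>Congruence in the complement of an obstacle\<close>

definition Kc_homotopy ::
    "(real ^ 'n) set \<Rightarrow> (real ^ 'n) set \<Rightarrow> 'n::finite motion \<Rightarrow> (real \<Rightarrow> 'n motion) \<Rightarrow> bool" where
  "Kc_homotopy K M g \<psi> \<longleftrightarrow>
     continuous_on {0..1} \<psi> \<and> \<psi> ` {0..1} \<subseteq> SE \<and>
     act (\<psi> 0) = id \<and> act (\<psi> 1) = act g \<and>
     (\<forall>t\<in>{0<..<1}. act (\<psi> t) ` M \<inter> K = {})"

definition Kc_congruent :: "(real ^ 'n) set \<Rightarrow> (real ^ 'n) set \<Rightarrow> (real ^ 'n::finite) set \<Rightarrow> bool" where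
  "Kc_congruent K M M' \<longleftrightarrow>
     (\<exists>g\<in>SE. act g ` M = M' \<and> (\<exists>\<psi>. Kc_homotopy K M g \<psi>))"

text \<open>For \<open>\<gg> \<in> se\<close> the path \<open>t \<mapsto> exp (t \<gg>)\<close> is continuous, stays in \<^const>\<open>SE\<close> and starts at the
  identity, so being a homotopy only amounts to avoiding the obstacle.\<close>

definition first_Kc_congruent ::
    "(real ^ 'n) set \<Rightarrow> (real ^ 'n) set \<Rightarrow> (real ^ 'n::finite) set \<Rightarrow> bool" where
  "first_Kc_congruent K M M' \<longleftrightarrow>
     Kc_congruent K M M' \<and>
     (\<exists>\<gg>\<in>se. act (exp_se \<gg>) ` M = M' \<and>
        (\<forall>t\<in>{0<..<1}. act (exp_se (t *\<^sub>R \<gg>)) ` M \<inter> K = {}))"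

end

theory Submission
  imports Defs "HOL-Homology.Invariance_of_Domain" "HOL-Complex_Analysis.Cauchy_Integral_Formula"
begin

text \<open>Fix two coordinates \<open>a \<noteq> b\<close>.  The obstacle is the coordinate subspace \<open>x\<^sub>a = x\<^sub>b = 0\<close> of
  codimension two, and the body is the complement of the closed set \<open>C\<close> made of the slit
  \<open>x\<^sub>a = 0\<close> and the pocket \<open>x\<^sub>a \<ge> 0, x\<^sub>b \<ge> 1\<close>.  A motion of the body that avoids the obstacle is,
  seen from the body, a motion of the obstacle inside \<open>C\<close>.  The obstacle starts in the slit; it
  can be pushed along the slit into the pocket and then sideways, off the slit, into the
  interior of the pocket.  This broken line of translations is the homotopy.

  A simple Euclidean move cannot turn the corner.  Seen from the body, it takes the origin along an
  orbit of a one-parameter group of motions, and the coordinates of such an orbit are entire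
  power series in the time (\<open>act_exp_se_coordinate_sums\<close>).  As long as
  \<open>x\<^sub>b < 1\<close>, the orbit must have \<open>x\<^sub>a = 0\<close>, so that \<open>x\<^sub>a\<close> vanishes at all
  times (\<open>entire_powser_zero\<close>).  But it has to end at a point with \<open>x\<^sub>a > 0\<close>: the origin has a
  neighbourhood disjoint from the moved body, whereas every point with \<open>x\<^sub>a \<le> 0\<close> is a limit of
  points of the body (\<open>preimage_of_origin_beyond_slit\<close>).  That last argument applies to every
  motion carrying the body to the moved body, and hence deals at once with all symmetries of the
  body and all logarithms of a motion.\<close>

section \<open>Open subsets of linear subspaces are manifolds\<close>

lemma second_countable_euclidean:
  "second_countable (euclidean :: 'a::second_countable_topology topology)"
proof -
  obtain B :: "'a set set" where "countable B" "topological_basis B"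
    using ex_countable_basis by blast
  then show ?thesis
    unfolding second_countable_def
    by (intro exI[of _ B]) (simp, meson topological_basisE topological_basis_open)
qed

text \<open>One chart suffices, the restriction of linear coordinates of the ambient subspace.  The full
  subspace yields the obstacle, the open sets of the whole space yield the bodies.\<close>

lemma l_subspace_openin_subspace:
  assumes "subspace S" "openin (top_of_set S) U"
  shows "l_subspace (dim S) U"
proof -
  obtain f where f: "homeomorphic_map (top_of_set S) (Euclidean_space (dim S)) f"
    using homeomorphic_subspace_Euclidean_space[OF assms(1)] homeomorphic_space by blast
  have US: "U \<subseteq> S"
    using assms(2) openin_imp_subset by blast
  have V: "openin (Euclidean_space (dim S)) (f ` U)"
    using homeomorphic_map_openness[OF f] US assms(2) by simp
  have "homeomorphic_map (subtopology (top_of_set S) U)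
          (subtopology (Euclidean_space (dim S)) (f ` U)) f"
    by (rule homeomorphic_map_subtopologies[OF f])
       (use US openin_subset[OF V] in \<open>auto simp: Int_absorb1\<close>)
  then have "top_of_set U homeomorphic_space subtopology (Euclidean_space (dim S)) (f ` U)"
    using US by (auto simp: homeomorphic_space subtopology_subtopology Int_absorb1)
  with V show ?thesis
    unfolding l_subspace_def topological_manifold_def
    by (auto simp: second_countable_euclidean second_countable_subtopology
        Hausdorff_space_subtopology subtopology_subtopology intro!: exI[of _ U] exI[of _ "f ` U"])
qed

corollary l_subspace_open:
  fixes U :: "(real ^ 'n) set"
  assumes "open U"
  shows "l_subspace CARD('n) U"
  using l_subspace_openin_subspace[OF subspace_UNIV, of U] assms by (simp add: dim_UNIV)

section \<open>One-parameter groups of motions\<close>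

lemma mat_pow_add: "mat_pow A (i + j) = mat_pow A i ** mat_pow A j"
  by (induction i) (simp_all add: matrix_mul_assoc)

lemma mat_pow_scaleR: "mat_pow (t *\<^sub>R A) k = t ^ k *\<^sub>R mat_pow A k"
  for A :: "real ^ 'm ^ 'm"
  by (induction k) (simp_all add: scalar_matrix_assoc[symmetric] matrix_scalar_ac)

lemma mat_exp_0: "mat_exp 0 = (mat 1 :: real ^ 'm ^ 'm)"
proof -
  have "mat_pow (0 :: real ^ 'm ^ 'm) k = (if k = 0 then mat 1 else 0)" for k
    by (cases k) simp_all
  then have "(\<lambda>k. (1 / fact k) *\<^sub>R mat_pow (0 :: real ^ 'm ^ 'm) k) = (\<lambda>k. if k = 0 then mat 1 else 0)"
    by auto
  then show ?thesis
    using sums_unique[OF sums_single[of 0 "\<lambda>_. mat 1 :: real ^ 'm ^ 'm"]] by (simp add: mat_exp_def)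
qed

lemma mat_exp_scaleR_entry_sums:
  fixes A :: "real ^ 'm ^ 'm"
  shows "(\<lambda>k. mat_pow A k $ i $ j / fact k * t ^ k) sums (mat_exp (t *\<^sub>R A) $ i $ j)"
  using mat_exp_entry_sums[of "t *\<^sub>R A" i j] by (simp add: mat_pow_scaleR mult.commute)

lemma summable_norm_mat_exp_entry:
  fixes A :: "real ^ 'm ^ 'm"
  shows "summable (\<lambda>k. norm (mat_pow A k $ i $ j / fact k * t ^ k))"
proof (rule powser_insidea)
  show "summable (\<lambda>k. mat_pow A k $ i $ j / fact k * (\<bar>t\<bar> + 1) ^ k)"
    by (rule sums_summable[OF mat_exp_scaleR_entry_sums])
qed simp

text \<open>Cauchy product of the two exponential series, entry by entry: the coefficients combine by the
  binomial theorem because powers of a single matrix commute.\<close>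

lemma mat_exp_add_scaleR:
  fixes A :: "real ^ 'm ^ 'm"
  shows "mat_exp (s *\<^sub>R A) ** mat_exp (t *\<^sub>R A) = mat_exp ((s + t) *\<^sub>R A)"
proof -
  let ?a = "\<lambda>s i j k. mat_pow A k $ i $ j / fact k * s ^ k"
  have "(mat_exp (s *\<^sub>R A) ** mat_exp (t *\<^sub>R A)) $ i $ j = mat_exp ((s + t) *\<^sub>R A) $ i $ j" for i j
  proof (rule sums_unique2)
    have "(\<lambda>k. \<Sum>p\<le>k. ?a s i l p * ?a t l j (k - p)) sums
            (mat_exp (s *\<^sub>R A) $ i $ l * mat_exp (t *\<^sub>R A) $ l $ j)" for l
      using Cauchy_product_sums[OF summable_norm_mat_exp_entry summable_norm_mat_exp_entry,
          of A i l s A l j t]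
      by (simp only: sums_unique[OF mat_exp_scaleR_entry_sums, symmetric])
    then show "(\<lambda>k. \<Sum>l\<in>UNIV. \<Sum>p\<le>k. ?a s i l p * ?a t l j (k - p)) sums
        ((mat_exp (s *\<^sub>R A) ** mat_exp (t *\<^sub>R A)) $ i $ j)"
      unfolding matrix_matrix_mult_def by (simp add: sums_sum)
    have "(\<Sum>l\<in>UNIV. \<Sum>p\<le>k. ?a s i l p * ?a t l j (k - p)) = ?a (s + t) i j k" for k
    proof -
      have "(\<Sum>l\<in>UNIV. \<Sum>p\<le>k. ?a s i l p * ?a t l j (k - p)) =
          (\<Sum>p\<le>k. \<Sum>l\<in>UNIV. ?a s i l p * ?a t l j (k - p))"
        by (rule sum.swap)
      also have "\<dots> = (\<Sum>p\<le>k. (s ^ p / fact p) * (t ^ (k - p) / fact (k - p)) *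
          (mat_pow A p ** mat_pow A (k - p)) $ i $ j)"
        by (simp add: matrix_matrix_mult_def sum_distrib_left mult_ac)
      also have "\<dots> = (\<Sum>p\<le>k. (s ^ p / fact p) * (t ^ (k - p) / fact (k - p))) * mat_pow A k $ i $ j"
        by (simp add: mat_pow_add[symmetric] sum_distrib_right)
      also have "(\<Sum>p\<le>k. (s ^ p / fact p) * (t ^ (k - p) / fact (k - p))) = (s + t) ^ k / fact k"
        using exp_series_add_commuting[of s t k] by (simp add: divide_inverse mult.commute)
      finally show ?thesis by simp
    qed
    then show "(\<lambda>k. \<Sum>l\<in>UNIV. \<Sum>p\<le>k. ?a s i l p * ?a t l j (k - p)) sums
        (mat_exp ((s + t) *\<^sub>R A) $ i $ j)"
      using mat_exp_scaleR_entry_sums[of A i j "s + t"] by simp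
  qed
  then show ?thesis by (simp add: vec_eq_iff)
qed

text \<open>The column \<open>(1, x)\<close>, on which motions act linearly; this turns statements about the action
  into statements about matrix exponentials.\<close>

definition homogeneous :: "real ^ 'n \<Rightarrow> real ^ 'n option" where
  "homogeneous x = (\<chi> i. case i of None \<Rightarrow> 1 | Some a \<Rightarrow> x $ a)"

lemma homogeneous_inject: "homogeneous x = homogeneous y \<longleftrightarrow> x = y"
  by (auto simp: homogeneous_def vec_eq_iff split: option.splits)

lemma sum_UNIV_option:
  fixes f :: "'n::finite option \<Rightarrow> real"
  shows "(\<Sum>i\<in>UNIV. f i) = f None + (\<Sum>a\<in>UNIV. f (Some a))"
  unfolding UNIV_option_conv by (subst sum.insert) (auto simp: sum.reindex)

lemma homogeneous_act: "homogeneous (act g x) = SE_matrix g *v homogeneous x"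
  by (auto simp: homogeneous_def vec_eq_iff matrix_vector_mult_def sum_UNIV_option SE_matrix_def act_def
      split: option.splits)

lemma homogeneous_act_exp_se:
  "homogeneous (act (exp_se (t *\<^sub>R g)) x) = mat_exp (t *\<^sub>R se_matrix g) *v homogeneous x"
proof -
  have "se_matrix (t *\<^sub>R g) = t *\<^sub>R se_matrix g"
    by (simp add: se_matrix_def vec_eq_iff split: option.splits)
  then show ?thesis
    by (simp add: homogeneous_act SE_matrix_exp_se)
qed

lemma act_exp_se_add:
  "act (exp_se (s *\<^sub>R g)) (act (exp_se (t *\<^sub>R g)) x) = act (exp_se ((s + t) *\<^sub>R g)) x"
  by (subst homogeneous_inject[symmetric])
     (simp add: homogeneous_act_exp_se matrix_vector_mul_assoc mat_exp_add_scaleR)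

lemma act_exp_se_zero: "act (exp_se (0 *\<^sub>R g)) x = x"
  by (subst homogeneous_inject[symmetric]) (subst homogeneous_act_exp_se, simp add: mat_exp_0)

text \<open>The coefficients depend on the coordinate and on the starting point, not on the time: a coordinate
  of an orbit is a fixed linear combination of entries of \<open>mat_exp (t *\<^sub>R A)\<close>, each of which is
  a power series in \<open>t\<close>.\<close>

lemma act_exp_se_coordinate_sums:
  "\<exists>c. \<forall>t. (\<lambda>k. c k * t ^ k) sums (act (exp_se (t *\<^sub>R g)) x $ i)"
proof -
  let ?A = "se_matrix g"
  let ?c = "\<lambda>k. \<Sum>l\<in>UNIV. mat_pow ?A k $ Some i $ l / fact k * homogeneous x $ l"
  have "(\<lambda>k. ?c k * t ^ k) sums (act (exp_se (t *\<^sub>R g)) x $ i)" for t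
  proof -
    have "act (exp_se (t *\<^sub>R g)) x $ i = homogeneous (act (exp_se (t *\<^sub>R g)) x) $ Some i"
      by (simp add: homogeneous_def)
    also have "\<dots> = (\<Sum>l\<in>UNIV. mat_exp (t *\<^sub>R ?A) $ Some i $ l * homogeneous x $ l)"
      by (simp add: homogeneous_act_exp_se matrix_vector_mult_def)
    finally have *: "act (exp_se (t *\<^sub>R g)) x $ i = \<dots>" .
    have "(\<lambda>k. \<Sum>l\<in>UNIV. (mat_pow ?A k $ Some i $ l / fact k * t ^ k) * homogeneous x $ l) sums
        (act (exp_se (t *\<^sub>R g)) x $ i)"
      unfolding * by (intro sums_sum sums_mult2 mat_exp_scaleR_entry_sums)
    then show ?thesis
      by (simp add: sum_distrib_left sum_distrib_right mult_ac)
  qed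
  then show ?thesis by (intro exI[of _ ?c]) blast
qed

section \<open>Entire real power series\<close>

lemma entire_powser_isCont:
  fixes f :: "real \<Rightarrow> real"
  assumes "\<And>t. (\<lambda>k. c k * t ^ k) sums f t"
  shows "isCont f t"
proof -
  have "f = (\<lambda>t. suminf (\<lambda>k. c k * t ^ k))"
    using assms sums_unique by blast
  moreover have "isCont (\<lambda>t. suminf (\<lambda>k. c k * t ^ k)) t"
    using assms sums_summable by (blast intro: isCont_powser_converges_everywhere)
  ultimately show ?thesis by simp
qed

text \<open>A one-sided identity theorem: the zeros of a nonzero power series do not accumulate at the
  centre, so that vanishing just after time 0 suffices.\<close>

lemma entire_powser_zero:
  fixes f :: "real \<Rightarrow> real"
  assumes sums: "\<And>t. (\<lambda>k. c k * t ^ k) sums f t"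
    and "\<delta> > 0" and zero: "\<And>t. 0 \<le> t \<Longrightarrow> t < \<delta> \<Longrightarrow> f t = 0"
  shows "f t = 0"
proof (rule ccontr)
  assume "f t \<noteq> 0"
  have "\<exists>m. c m \<noteq> 0"
  proof (rule ccontr)
    assume "\<nexists>m. c m \<noteq> 0"
    then have "(\<lambda>k. 0) sums f t" using sums[of t] by simp
    from sums_unique2[OF this sums_zero] \<open>f t \<noteq> 0\<close> show False by simp
  qed
  then obtain m where m: "c m \<noteq> 0" ..
  have f0: "f 0 = 0" using zero \<open>\<delta> > 0\<close> by simp
  have "c 0 = 0"
    using sums_unique2[OF powser_sums_zero sums[of 0]] f0 by simp
  with m have "m > 0" by (cases m) auto
  obtain s where s: "s > 0" "\<And>z. z \<in> cball 0 s - {0} \<Longrightarrow> f z \<noteq> 0"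
    using powser_0_nonzero[of 1 0 c f m] sums f0 m \<open>m > 0\<close> by auto
  let ?z = "min s (\<delta> / 2)"
  have "f ?z = 0" using zero s(1) \<open>\<delta> > 0\<close> by simp
  with s \<open>\<delta> > 0\<close> show False by (auto simp: min_def split: if_splits)
qed

section \<open>A slit that opens into a pocket\<close>

definition obstacle :: "'n \<Rightarrow> 'n \<Rightarrow> (real ^ 'n) set" where
  "obstacle a b = {x. x $ a = 0 \<and> x $ b = 0}"

text \<open>The complement of the slit \<open>x\<^sub>a = 0\<close> and the pocket \<open>x\<^sub>a \<ge> 0, x\<^sub>b \<ge> 1\<close>.\<close>

definition body :: "'n \<Rightarrow> 'n \<Rightarrow> (real ^ 'n) set" where
  "body a b = {x. x $ a < 0 \<or> (x $ a > 0 \<and> x $ b < 1)}"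

text \<open>The body is translated by \<open>-s\<close>, where the position \<open>s\<close> of the origin relative to the body
  runs along the slit from \<open>0\<close> to the unit vector of \<open>b\<close>, and then diagonally to the inner
  point \<open>x\<^sub>a = 1, x\<^sub>b = 2\<close> of the pocket.  It leaves the slit after \<open>t = 1 / 2\<close>, when its
  coordinate \<open>x\<^sub>b = 2 * t\<close> has reached the pocket.\<close>

definition slide :: "'n \<Rightarrow> 'n \<Rightarrow> real \<Rightarrow> 'n::finite motion" where
  "slide a b t = (- (max 0 (2 * t - 1) *\<^sub>R axis a 1 + (2 * t) *\<^sub>R axis b 1), mat 1)"

lemma act_slide: "act (slide a b t) x = x - (max 0 (2 * t - 1) *\<^sub>R axis a 1 + (2 * t) *\<^sub>R axis b 1)"
  by (simp add: act_def slide_def)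

lemma slide_in_SE: "slide a b t \<in> SE"
  by (simp add: SE_def slide_def rotation_matrix_def orthogonal_matrix_id)

lemma l_subspace_obstacle:
  fixes a b :: "'n::finite"
  assumes "a \<noteq> b"
  shows "l_subspace (CARD('n) - 2) (obstacle a b)" "finite (components (obstacle a b))"
proof -
  have sub: "subspace (obstacle a b)"
    by (auto simp: obstacle_def subspace_def)
  have "obstacle a b = {x. \<forall>i. i \<notin> - {a, b} \<longrightarrow> x $ i = 0}"
    by (auto simp: obstacle_def)
  then have "dim (obstacle a b) = card (- {a, b})"
    using dim_substandard_cart[of "- {a, b}", where 'a = real] by (simp add: dim_vec_eq)
  also have "\<dots> = CARD('n) - 2"
    using assms by (simp add: card_Diff_subset Compl_eq_Diff_UNIV)
  finally show "l_subspace (CARD('n) - 2) (obstacle a b)"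
    using l_subspace_openin_subspace[OF sub openin_subtopology_self] by simp
  have "connected (obstacle a b)"
    using sub by (simp add: convex_connected subspace_imp_convex)
  moreover have "0 \<in> obstacle a b"
    by (simp add: obstacle_def)
  ultimately have "components (obstacle a b) = {obstacle a b}"
    by (auto simp: components_eq_sing_iff)
  then show "finite (components (obstacle a b))"
    by simp
qed

lemma open_body: "open (body a b)"
  unfolding body_def by (intro open_Collect_disj open_Collect_conj open_Collect_less continuous_intros)

lemma slide_avoids_obstacle:
  assumes "a \<noteq> b"
  shows "act (slide a b t) ` body a b \<inter> obstacle a b = {}"
  using assms by (force simp: act_slide body_def obstacle_def axis_def max_def split: if_splits)

lemma Kc_congruent_body:
  assumes "a \<noteq> b"
  shows "Kc_congruent (obstacle a b) (body a b) (act (slide a b 1) ` body a b)"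
proof -
  have "continuous_on {0..1} (slide a b)"
    unfolding slide_def by (intro continuous_intros)
  then have "Kc_homotopy (obstacle a b) (body a b) (slide a b 1) (slide a b)"
    using slide_avoids_obstacle[OF assms] slide_in_SE
    by (auto simp: Kc_homotopy_def fun_eq_iff act_slide)
  then show ?thesis
    unfolding Kc_congruent_def using slide_in_SE by blast
qed

text \<open>At the end of the slide, the origin sits at the point \<open>x\<^sub>a = 1, x\<^sub>b = 2\<close> of the pocket, whose
  boundary is at distance 1.\<close>

lemma moved_body_far_from_origin:
  assumes "a \<noteq> b" "x \<in> act (slide a b 1) ` body a b"
  shows "norm x \<ge> 1"
proof -
  obtain z where z: "z \<in> body a b" "x = z - (axis a 1 + 2 *\<^sub>R axis b 1)"
    using assms(2) by (auto simp: act_slide)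
  then have "x $ a < -1 \<or> x $ b < -1"
    using assms(1) by (auto simp: body_def axis_def)
  then show ?thesis
    using component_le_norm_cart[of x a] component_le_norm_cart[of x b] by linarith
qed

text \<open>If \<open>y $ a \<le> 0\<close>, then \<open>y\<close> would be a limit of points of the body with \<open>x\<^sub>a < 0\<close>; their
  images would be points of the moved body that converge to the origin.\<close>

lemma preimage_of_origin_beyond_slit:
  assumes "a \<noteq> b" "act h ` body a b = act (slide a b 1) ` body a b" "act h y = 0"
  shows "y $ a > 0"
proof (rule ccontr)
  assume "\<not> y $ a > 0"
  define z where "z \<epsilon> = y - \<epsilon> *\<^sub>R axis a 1" for \<epsilon> :: real
  have "z \<epsilon> \<in> body a b" if "\<epsilon> > 0" for \<epsilon>
    using \<open>\<not> y $ a > 0\<close> that by (simp add: z_def body_def axis_def)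
  then have far: "norm (act h (z \<epsilon>)) \<ge> 1" if "\<epsilon> > 0" for \<epsilon>
    using moved_body_far_from_origin[OF assms(1)] assms(2) that by blast
  have "isCont (\<lambda>\<epsilon>. norm (act h (z \<epsilon>))) 0"
    unfolding act_def z_def
    by (intro continuous_intros bounded_linear.isCont[OF matrix_vector_mul_bounded_linear])
  moreover have "norm (act h (z 0)) = 0"
    using assms(3) by (simp add: z_def)
  ultimately have "\<exists>\<delta>>0. \<forall>\<epsilon>. \<bar>\<epsilon>\<bar> < \<delta> \<longrightarrow> norm (act h (z \<epsilon>)) < 1"
    unfolding continuous_at_eps_delta dist_real_def by (auto dest: spec[of _ 1])
  then obtain \<delta> where "\<delta> > 0" "norm (act h (z (\<delta> / 2))) < 1"
    by (metis abs_of_pos half_gt_zero field_sum_of_halves less_add_same_cancel1)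
  with far[of "\<delta> / 2"] show False by force
qed

lemma not_first_Kc_congruent_body:
  assumes "a \<noteq> b"
  shows "\<not> first_Kc_congruent (obstacle a b) (body a b) (act (slide a b 1) ` body a b)"
proof
  assume "first_Kc_congruent (obstacle a b) (body a b) (act (slide a b 1) ` body a b)"
  then obtain g
    where g: "act (exp_se g) ` body a b = act (slide a b 1) ` body a b"
      and avoids: "\<forall>t\<in>{0<..<1}. act (exp_se (t *\<^sub>R g)) ` body a b \<inter> obstacle a b = {}"
    unfolding first_Kc_congruent_def by (elim conjE bexE) (rule that)
  \<comment> \<open>The origin as seen from the moving body: the inverse motions form the group of \<open>- g\<close>.\<close>
  define y where "y t = act (exp_se (t *\<^sub>R (- g))) 0" for t
  have y0: "y 0 = 0"
    using act_exp_se_zero by (auto simp: y_def)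
  have cancel: "act (exp_se (t *\<^sub>R g)) (y t) = 0" for t
    using act_exp_se_add[of t g "- t" 0] act_exp_se_zero[of g 0] by (simp add: y_def)
  have y_out: "y t \<notin> body a b" if "t \<in> {0<..<1}" for t
  proof
    assume "y t \<in> body a b"
    then have "0 \<in> act (exp_se (t *\<^sub>R g)) ` body a b"
      using cancel[of t] by (metis imageI)
    moreover have "0 \<in> obstacle a b"
      by (simp add: obstacle_def)
    ultimately show False
      using bspec[OF avoids that] by blast
  qed
  obtain c where c: "\<And>t. (\<lambda>k. c k * t ^ k) sums (y t $ a)"
    using act_exp_se_coordinate_sums[of "- g" 0 a] unfolding y_def by blast
  obtain d where d: "\<And>t. (\<lambda>k. d k * t ^ k) sums (y t $ b)"
    using act_exp_se_coordinate_sums[of "- g" 0 b] unfolding y_def by blast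
  \<comment> \<open>For a while the orbit stays below the pocket, so only the slit is left to it.\<close>
  have "isCont (\<lambda>t. y t $ b) 0"
    using d by (rule entire_powser_isCont)
  then have "((\<lambda>t. y t $ b) \<longlongrightarrow> 0) (at 0)"
    by (simp add: isCont_def y0)
  then have "\<forall>\<^sub>F t in at 0. y t $ b < 1"
    by (rule order_tendstoD) simp
  then obtain \<delta> where \<delta>: "\<delta> > 0" "\<And>t. t \<noteq> 0 \<Longrightarrow> \<bar>t\<bar> < \<delta> \<Longrightarrow> y t $ b < 1"
    unfolding eventually_at dist_real_def by auto
  have "y t $ a = 0" if "0 \<le> t" "t < min \<delta> 1" for t
  proof (cases "t = 0")
    case False
    then have "y t $ b < 1" "y t \<notin> body a b"
      using \<delta>(2)[of t] y_out[of t] that by auto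
    then show ?thesis
      by (auto simp: body_def)
  qed (simp add: y0)
  then have "y 1 $ a = 0"
    using entire_powser_zero[OF c, of "min \<delta> 1" 1] \<delta>(1) by simp
  moreover have "y 1 $ a > 0"
    using preimage_of_origin_beyond_slit[OF assms g] cancel[of 1] by simp
  ultimately show False by simp
qed

theorem theorem3p8:
  assumes "CARD('n::finite) \<ge> 2"
  shows "\<exists>K M M' :: (real ^ 'n) set.
           l_subspace (CARD('n) - 2) K \<and> finite (components K) \<and>
           l_subspace CARD('n) M \<and> l_subspace CARD('n) M' \<and>
           M \<subseteq> - K \<and> M' \<subseteq> - K \<and>
           Kc_congruent K M M' \<and> \<not> first_Kc_congruent K M M'"
proof -
  obtain a b :: 'n where ab: "a \<noteq> b"
    using assms card_le_Suc0_iff_eq[of "UNIV :: 'n set"] by force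
  let ?M' = "act (slide a b 1) ` body a b"
  have "?M' = (+) (- (axis a 1 + 2 *\<^sub>R axis b 1)) ` body a b"
    by (intro image_cong) (simp_all add: act_slide)
  then have "open ?M'"
    using open_translation[OF open_body] by metis
  moreover have "body a b \<subseteq> - obstacle a b"
    by (auto simp: body_def obstacle_def)
  moreover have "?M' \<subseteq> - obstacle a b"
    using slide_avoids_obstacle[OF ab] by blast
  ultimately show ?thesis
    using l_subspace_obstacle[OF ab] l_subspace_open[OF open_body[of a b]] l_subspace_open[of ?M']
      Kc_congruent_body[OF ab] not_first_Kc_congruent_body[OF ab]
    by (intro exI[of _ "obstacle a b"] exI[of _ "body a b"] exI[of _ ?M'] conjI) assumption+
qed

end
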